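(* Let $k,d\in\mathbb{N}$ and $m^{(d)}=(m_1,\ldots,m_d)\in\mathbb{N}^d$. Define $g_d=\sum_{w\in T(m^{(d)},k)}\mathrm{cycdes}(w)$, the total number of descents and cyclic descents of all $m^{(d)}$-tensor words over $[k]$. Then $$g_d=\frac{1}{2}\left(d\prod_{\ell\in[d]}m_{\ell}\right)(k-1)k^{\prod_{\ell\in[d]}m_{\ell}-1}.$$ Moreover, for $m_{d+1}\in\mathbb{N}$ let $g_{d+1}=\sum_{w\in T(m^{(d+1)},k)}\mathrm{cycdes}(w)$, where $m^{(d+1)}=(m_1,\ldots,m_d,m_{d+1})$, and, with $m_1,\ldots,m_d$ fixed, let $G_{d+1}(x)=\sum_{m_{d+1}\geq 1}g_{d+1}\,x^{m_{d+1}}$ be the corresponding generating function. Then $$G_{d+1}(x)=\frac{2\left(\frac{1}{2}(k-1)k^{2\prod_{\ell\in[d]}m_{\ell}-1}\prod_{\ell\in[d]}m_{\ell}+k^{\prod_{\ell\in[d]}m_{\ell}}g_{d}\right)}{\left(1-k^{\prod_{\ell\in[d]}m_{\ell}}x\right)^{2}}x^{2}-\frac{\frac{1}{2}(k-1)k^{3\prod_{\ell\in[d]}m_{\ell}-1}\prod_{\ell\in[d]}m_{\ell}+k^{2\prod_{\ell\in[d]}m_{\ell}}g_{d}}{\left(1-k^{\prod_{\ell\in[d]}m_{\ell}}x\right)^{2}}x^{3}.$$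
   Context: $\mathbb{N}$ is the set of natural numbers $\{1,2,\ldots\}$ and $[n]=\{1,\ldots,n\}$. For $m^{(d)}=(m_1,\ldots,m_d)\in\mathbb{N}^d$, an $m^{(d)}$-tensor word over $[k]$ is a function $w\colon[m_1]\times\cdots\times[m_d]\to[k]$; $T(m^{(d)},k)$ denotes the set of all of them. With $e_\ell$ the $\ell$th standard basis vector of $\mathbb{R}^d$, a descent of $w$ is a pair $(i,j)\in([m_1]\times\cdots\times[m_d])^2$ such that $w(i)>w(j)$ and $j=i+e_\ell$ for some $\ell\in[d]$. A cyclic descent of $w$ is a pair $(i,j)\in([m_1]\times\cdots\times[m_d])^2$ such that $w(i)>w(j)$ and there exists a unique $\ell\in[d]$ with $i_\ell=m_\ell$, $j_\ell=1$, and $i_r=j_r$ for all $r\in[d]\setminus\{\ell\}$. $\mathrm{cycdes}(w)$ denotes the number of descents and cyclic descents of $w$. These notions are used in the same way for $d+1$ in place of $d$.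
   Formalization: The formula for g_d is stated only when k=1 or all m_ℓ≥2 (it fails otherwise, e.g. d=1, m_1=1, k=2), and the formula for G_{d+1}(x) gets the missing term g_d·x (the coefficient at m_{d+1}=1), needed e.g. for d=1, m_1=2, k=2. *)

theory Defs
  imports
    Complex_Main
    "HOL-Library.FuncSet"
    "HOL-Computational_Algebra.Formal_Power_Series"
begin

text \<open>
  A dimension vector \<open>(m\<^sub>1, \<dots>, m\<^sub>d)\<close> is a function \<open>m\<close> on naturals of which only the values
  at \<open>1, \<dots>, d\<close> matter; appending \<open>m\<^sub>d\<^sub>+\<^sub>1 = n\<close> is \<open>m(d + 1 := n)\<close>.  Positions and words are
  extensional functions, so that finite function spaces are counted correctly.
\<close>

definition positions :: "nat \<Rightarrow> (nat \<Rightarrow> nat) \<Rightarrow> (nat \<Rightarrow> nat) set" where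
  "positions d m = (\<Pi>\<^sub>E l\<in>{1..d}. {1..m l})"

definition tensor_words :: "nat \<Rightarrow> (nat \<Rightarrow> nat) \<Rightarrow> nat \<Rightarrow> ((nat \<Rightarrow> nat) \<Rightarrow> nat) set" where
  "tensor_words d m k = (positions d m \<rightarrow>\<^sub>E {1..k})"

definition descents ::
    "nat \<Rightarrow> (nat \<Rightarrow> nat) \<Rightarrow> ((nat \<Rightarrow> nat) \<Rightarrow> nat) \<Rightarrow> ((nat \<Rightarrow> nat) \<times> (nat \<Rightarrow> nat)) set" where
  "descents d m w =
    {(i, j). i \<in> positions d m \<and> j \<in> positions d m \<and> w i > w j \<and>
             (\<exists>l\<in>{1..d}. j = i(l := i l + 1))}"

definition cyclic_descents ::
    "nat \<Rightarrow> (nat \<Rightarrow> nat) \<Rightarrow> ((nat \<Rightarrow> nat) \<Rightarrow> nat) \<Rightarrow> ((nat \<Rightarrow> nat) \<times> (nat \<Rightarrow> nat)) set" where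
  "cyclic_descents d m w =
    {(i, j). i \<in> positions d m \<and> j \<in> positions d m \<and> w i > w j \<and>
             (\<exists>!l. l \<in> {1..d} \<and> i l = m l \<and> j l = 1 \<and> (\<forall>r\<in>{1..d} - {l}. i r = j r))}"

definition cycdes :: "nat \<Rightarrow> (nat \<Rightarrow> nat) \<Rightarrow> ((nat \<Rightarrow> nat) \<Rightarrow> nat) \<Rightarrow> nat" where
  "cycdes d m w = card (descents d m w) + card (cyclic_descents d m w)"

definition total_cycdes :: "nat \<Rightarrow> (nat \<Rightarrow> nat) \<Rightarrow> nat \<Rightarrow> nat" where
  "total_cycdes d m k = (\<Sum>w\<in>tensor_words d m k. cycdes d m w)"

text \<open>
  The series \<open>G\<^sub>d\<^sub>+\<^sub>1\<close>, summed over all \<open>m\<^sub>d\<^sub>+\<^sub>1 \<ge> 1\<close> with \<open>m\<^sub>1, \<dots>, m\<^sub>d\<close> fixed; the first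
  argument is \<open>d\<close>, not \<open>d + 1\<close>.  Pitfall: a direction of length 1 contributes neither descents nor
  cyclic descents (they would be pairs \<open>(i, i)\<close>), so the coefficient at \<open>m\<^sub>d\<^sub>+\<^sub>1 = 1\<close> is
  \<open>total_cycdes d m k\<close>, which does not follow the pattern of the later coefficients.
\<close>

definition cycdes_gf :: "nat \<Rightarrow> (nat \<Rightarrow> nat) \<Rightarrow> nat \<Rightarrow> real fps" where
  "cycdes_gf d m k =
    Abs_fps (\<lambda>n. if n \<ge> 1 then real (total_cycdes (d + 1) (m(d + 1 := n)) k) else 0)"

end

theory Submission
  imports Defs
begin

text \<open>
  The proof counts triples consisting of a word and one of its (cyclic) descents, choosing the
  pair of positions first.  For two distinct positions \<open>i\<close> and \<open>j\<close>, exchanging the two values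
  matches the words with \<open>w i > w j\<close> with those with \<open>w i < w j\<close>, and a word with \<open>w i = w j\<close> is
  determined by its values off \<open>i\<close>.  So exactly half of \<open>k\<^sup>M - k\<^sup>M\<^sup>-\<^sup>1\<close> words descend from \<open>i\<close> to \<open>j\<close>
  (\<open>card_functions_descending\<close>).  This number does not depend on the pair, and it remains to
  count pairs.  In a direction of length at least 2 every position has exactly one cyclic
  successor, and it is a different position: a step by one unless the position is at the end of
  the range, a wrap-around otherwise.  A direction of length 1 contributes nothing, because there
  the only wrap-around leads from a position to itself.  With \<open>r\<close> directions of length at least 2
  there are thus \<open>r M\<close> pairs (\<open>card_step_wrap_pairs\<close>), and the total is
  \<open>r M (k - 1) k\<^sup>M\<^sup>-\<^sup>1 / 2\<close> (\<open>total_cycdes_closed_form\<close>).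

  For the generating function put \<open>a = k\<^sup>M\<close> and \<open>B = (r + 1) M (k - 1) k\<^sup>M\<^sup>-\<^sup>1 / 2\<close>.  Adding a direction
  of length \<open>n \<ge> 2\<close> replaces \<open>M\<close> by \<open>M n\<close> and \<open>r\<close> by \<open>r + 1\<close>, so the coefficient at \<open>n\<close> is
  \<open>B n a\<^sup>n\<^sup>-\<^sup>1\<close>; for \<open>n = 1\<close> it is \<open>g\<close> instead of \<open>B\<close>.  Hence the series is
  \<open>g X + B X / (1 - a X)\<^sup>2 - B X\<close>, and the last two terms combine to the stated fractions.
\<close>

section \<open>Words that descend between two given positions\<close>

text \<open>
  Splitting all functions by the comparison of \<open>w i\<close> and \<open>w j\<close>: the two strict cases are exchanged
  by transposing the arguments \<open>i\<close> and \<open>j\<close>, and the case of equality is a free choice of the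
  values off \<open>i\<close>.
\<close>

lemma card_functions_descending:
  fixes A :: "'a set" and k :: nat
  assumes "finite A" "i \<in> A" "j \<in> A" "i \<noteq> j"
  shows "2 * card {w \<in> A \<rightarrow>\<^sub>E {1..k}. w i > w j} = (k - 1) * k ^ (card A - 1)"
proof -
  let ?W = "A \<rightarrow>\<^sub>E {1..k}"
  let ?gt = "{w \<in> ?W. w i > w j}" and ?lt = "{w \<in> ?W. w i < w j}" and ?eq = "{w \<in> ?W. w i = w j}"
  have fin: "finite ?W"
    using assms(1) by (intro finite_PiE) auto
  define \<sigma> where "\<sigma> = (\<lambda>w :: 'a \<Rightarrow> nat. w(i := w j, j := w i))"
  have "bij_betw \<sigma> ?gt ?lt"
    by (rule bij_betw_byWitness[where f' = \<sigma>])
       (use assms in \<open>auto simp: \<sigma>_def PiE_iff extensional_def fun_eq_iff\<close>)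
  hence lt: "card ?lt = card ?gt"
    by (simp add: bij_betw_same_card)
  have "bij_betw (\<lambda>w. restrict w (A - {i})) ?eq ((A - {i}) \<rightarrow>\<^sub>E {1..k})"
  proof (rule bij_betw_byWitness[where f' = "\<lambda>v. v(i := v j)"])
    show "\<forall>w\<in>?eq. (restrict w (A - {i}))(i := restrict w (A - {i}) j) = w"
    proof (intro ballI ext)
      fix w x assume "w \<in> ?eq"
      thus "((restrict w (A - {i}))(i := restrict w (A - {i}) j)) x = w x"
        using assms by (cases "x \<in> A") (auto simp: PiE_iff extensional_def)
    qed
    show "\<forall>v\<in>(A - {i}) \<rightarrow>\<^sub>E {1..k}. restrict (v(i := v j)) (A - {i}) = v"
    proof (intro ballI ext)
      fix v x assume "v \<in> (A - {i}) \<rightarrow>\<^sub>E {1..k}"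
      thus "restrict (v(i := v j)) (A - {i}) x = v x"
        by (cases "x \<in> A - {i}") (auto simp: PiE_iff extensional_def)
    qed
    show "(\<lambda>w. restrict w (A - {i})) ` ?eq \<subseteq> (A - {i}) \<rightarrow>\<^sub>E {1..k}"
      by (rule image_subsetI, rule restrict_PiE_iff[THEN iffD2]) blast
    show "(\<lambda>v. v(i := v j)) ` ((A - {i}) \<rightarrow>\<^sub>E {1..k}) \<subseteq> ?eq"
    proof (rule image_subsetI)
      fix v assume v: "v \<in> (A - {i}) \<rightarrow>\<^sub>E {1..k}"
      have "v(i := v j) \<in> insert i (A - {i}) \<rightarrow>\<^sub>E {1..k}"
        using v assms by (intro PiE_fun_upd PiE_mem[OF v]) auto
      thus "v(i := v j) \<in> ?eq"
        using assms by (simp add: insert_absorb)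
    qed
  qed
  hence eq: "card ?eq = k ^ (card A - 1)"
    using assms by (simp add: bij_betw_same_card card_PiE)
  have split: "?W = ?gt \<union> (?lt \<union> ?eq)"
    by auto
  have "card ?W = card ?gt + card (?lt \<union> ?eq)"
    by (subst split, rule card_Un_disjoint) (use fin in auto)
  moreover have "card (?lt \<union> ?eq) = card ?lt + card ?eq"
  proof (rule card_Un_disjoint)
    show "finite ?lt" "finite ?eq"
      by (rule finite_subset[OF _ fin], blast)+
    show "?lt \<inter> ?eq = {}"
      by (rule equals0I) (elim IntE CollectE conjE, linarith)
  qed
  moreover have "card ?W = k ^ card A"
    using assms(1) by (simp add: card_PiE)
  ultimately have "k ^ card A = 2 * card ?gt + k ^ (card A - 1)"
    unfolding lt eq by linarith
  moreover have "k ^ card A = k * k ^ (card A - 1)"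
    using assms by (metis card_gt_0_iff empty_iff power_eq_if not_gr0)
  ultimately show ?thesis
    by (simp add: diff_mult_distrib)
qed

section \<open>Neighbouring pairs of positions\<close>

lemma finite_positions: "finite (positions d m)"
  by (auto simp: positions_def intro: finite_PiE)

lemma card_positions: "card (positions d m) = (\<Prod>l\<in>{1..d}. m l)"
  by (simp add: positions_def card_PiE)

definition step_pairs :: "nat \<Rightarrow> (nat \<Rightarrow> nat) \<Rightarrow> ((nat \<Rightarrow> nat) \<times> (nat \<Rightarrow> nat)) set" where
  "step_pairs d m =
    {(i, j). i \<in> positions d m \<and> j \<in> positions d m \<and> (\<exists>l\<in>{1..d}. j = i(l := i l + 1))}"

text \<open>
  The condition \<open>i \<noteq> j\<close> removes the wrap-arounds in directions of length 1.  They can never carry a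
  descent, and without them all pairs contribute the same number of words.
\<close>

definition wrap_pairs :: "nat \<Rightarrow> (nat \<Rightarrow> nat) \<Rightarrow> ((nat \<Rightarrow> nat) \<times> (nat \<Rightarrow> nat)) set" where
  "wrap_pairs d m =
    {(i, j). i \<in> positions d m \<and> j \<in> positions d m \<and> i \<noteq> j \<and>
             (\<exists>l\<in>{1..d}. i l = m l \<and> j = i(l := 1))}"

lemma descents_eq: "descents d m w = {p \<in> step_pairs d m. w (fst p) > w (snd p)}"
  by (auto simp: descents_def step_pairs_def)

text \<open>
  Two directions witnessing the same wrap-around would force \<open>i = j\<close>, since each of them is among
  the coordinates on which \<open>i\<close> and \<open>j\<close> agree by the other.  As \<open>w i > w j\<close> excludes \<open>i = j\<close>, the
  uniqueness in the definition of cyclic descents is automatic.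
\<close>

lemma cyclic_descents_eq:
  "cyclic_descents d m w = {p \<in> wrap_pairs d m. w (fst p) > w (snd p)}"
proof -
  have upd: "(j l = 1 \<and> (\<forall>r\<in>{1..d} - {l}. i r = j r)) \<longleftrightarrow> j = i(l := 1)"
    if "i \<in> positions d m" "j \<in> positions d m" "l \<in> {1..d}" for i j :: "nat \<Rightarrow> nat" and l
  proof -
    have "i r = j r" if "r \<notin> {1..d}" for r
      using \<open>i \<in> _\<close> \<open>j \<in> _\<close> that by (auto simp: positions_def PiE_iff extensional_def)
    hence "(\<forall>r\<in>{1..d} - {l}. i r = j r) \<longleftrightarrow> (\<forall>r. r \<noteq> l \<longrightarrow> j r = i r)"
      by (metis DiffE DiffI singletonD singletonI)
    thus ?thesis
      by (simp add: fun_eq_iff) metis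
  qed
  have uniq: "(\<exists>!l. l \<in> {1..d} \<and> i l = m l \<and> j = i(l := 1)) \<longleftrightarrow>
              (\<exists>l\<in>{1..d}. i l = m l \<and> j = i(l := 1))" if "i \<noteq> j" for i j :: "nat \<Rightarrow> nat"
    using that by (metis fun_upd_apply fun_upd_triv)
  have "(i, j) \<in> cyclic_descents d m w \<longleftrightarrow>
        (i, j) \<in> {p \<in> wrap_pairs d m. w (fst p) > w (snd p)}" for i j
  proof (cases "i \<in> positions d m \<and> j \<in> positions d m \<and> w i > w j")
    case True
    hence "i \<noteq> j" by auto
    have "(\<exists>!l. l \<in> {1..d} \<and> i l = m l \<and> j l = 1 \<and> (\<forall>r\<in>{1..d} - {l}. i r = j r)) \<longleftrightarrow>
          (\<exists>!l. l \<in> {1..d} \<and> i l = m l \<and> j = i(l := 1))"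
      using True upd[of i j] by (intro arg_cong[where f = Ex1] ext) auto
    with True \<open>i \<noteq> j\<close> uniq[OF \<open>i \<noteq> j\<close>] show ?thesis
      by (simp add: cyclic_descents_def wrap_pairs_def)
  qed (auto simp: cyclic_descents_def wrap_pairs_def)
  thus ?thesis by auto
qed

text \<open>
  A pair in either set is recovered from its first entry and its direction, so both are counted
  direction by direction.  Positions below the end of a direction give a step, those at the end a
  wrap-around; together these are all positions.  Directions of length less than 2 have no
  position that can step, and their wrap-arounds are excluded.
\<close>

lemma card_step_wrap_pairs:
  "card (step_pairs d m) + card (wrap_pairs d m) = card {l \<in> {1..d}. m l \<ge> 2} * (\<Prod>l\<in>{1..d}. m l)"
proof -
  let ?P = "positions d m" and ?L = "{l \<in> {1..d}. m l \<ge> 2}"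
  have upd_eq: "i(l := x) = i(l' := y) \<Longrightarrow> x \<noteq> i l \<Longrightarrow> l = l'"
    for i :: "nat \<Rightarrow> nat" and l l' x y
    by (metis fun_upd_apply)
  have range: "1 \<le> i l \<and> i l \<le> m l" if "i \<in> ?P" "l \<in> {1..d}" for i l
    using that by (auto simp: positions_def PiE_iff)
  have upd: "i(l := x) \<in> ?P \<longleftrightarrow> x \<in> {1..m l}" if "i \<in> ?P" "l \<in> {1..d}" for i l x
    using that by (auto simp: positions_def PiE_iff extensional_def)
  have "bij_betw (\<lambda>(l, i). (i, i(l := i l + 1))) (SIGMA l:?L. {i \<in> ?P. i l < m l}) (step_pairs d m)"
    unfolding bij_betw_def
  proof
    show "inj_on (\<lambda>(l, i). (i, i(l := i l + 1))) (SIGMA l:?L. {i \<in> ?P. i l < m l})"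
      by (auto simp: inj_on_def dest!: upd_eq)
    show "(\<lambda>(l, i). (i, i(l := i l + 1))) ` (SIGMA l:?L. {i \<in> ?P. i l < m l}) = step_pairs d m"
    proof (intro set_eqI iffI)
      fix p assume "p \<in> step_pairs d m"
      then obtain i l where p: "p = (i, i(l := i l + 1))" "i \<in> ?P" "l \<in> {1..d}"
        and j: "i(l := i l + 1) \<in> ?P"
        by (auto simp: step_pairs_def)
      have "i l < m l" "m l \<ge> 2"
        using j upd[OF p(2,3)] range[OF p(2,3)] by auto
      thus "p \<in> (\<lambda>(l, i). (i, i(l := i l + 1))) ` (SIGMA l:?L. {i \<in> ?P. i l < m l})"
        using p by (intro image_eqI[of _ _ "(l, i)"]) auto
    qed (auto simp: step_pairs_def upd)
  qed
  hence step: "card (step_pairs d m) = (\<Sum>l\<in>?L. card {i \<in> ?P. i l < m l})"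
    using bij_betw_same_card finite_positions by (subst card_SigmaI[symmetric]) fastforce+
  have "bij_betw (\<lambda>(l, i). (i, i(l := 1))) (SIGMA l:?L. {i \<in> ?P. i l = m l}) (wrap_pairs d m)"
    unfolding bij_betw_def
  proof
    show "inj_on (\<lambda>(l, i). (i, i(l := 1))) (SIGMA l:?L. {i \<in> ?P. i l = m l})"
      by (auto simp: inj_on_def dest!: upd_eq)
    show "(\<lambda>(l, i). (i, i(l := 1))) ` (SIGMA l:?L. {i \<in> ?P. i l = m l}) = wrap_pairs d m"
    proof (intro set_eqI iffI)
      fix p assume "p \<in> wrap_pairs d m"
      then obtain i l where p: "p = (i, i(l := 1))" "i \<in> ?P" "l \<in> {1..d}"
        and l: "i l = m l" "i \<noteq> i(l := 1)"
        by (auto simp: wrap_pairs_def)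
      have "i l \<noteq> 1"
        using l(2) by (metis fun_upd_triv)
      hence "m l \<ge> 2"
        using range[OF p(2,3)] l(1) by auto
      thus "p \<in> (\<lambda>(l, i). (i, i(l := 1))) ` (SIGMA l:?L. {i \<in> ?P. i l = m l})"
        using p l by (intro image_eqI[of _ _ "(l, i)"]) auto
    next
      fix p assume "p \<in> (\<lambda>(l, i). (i, i(l := 1))) ` (SIGMA l:?L. {i \<in> ?P. i l = m l})"
      then obtain i l where p: "p = (i, i(l := 1))" "i \<in> ?P" "l \<in> {1..d}" "m l \<ge> 2" "i l = m l"
        by auto
      moreover have "i \<noteq> i(l := 1)"
        using p(4,5) by (auto simp: fun_eq_iff)
      ultimately show "p \<in> wrap_pairs d m"
        using upd[OF p(2,3)] by (auto simp: wrap_pairs_def)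
    qed
  qed
  hence wrap: "card (wrap_pairs d m) = (\<Sum>l\<in>?L. card {i \<in> ?P. i l = m l})"
    using bij_betw_same_card finite_positions by (subst card_SigmaI[symmetric]) fastforce+
  have "card {i \<in> ?P. i l < m l} + card {i \<in> ?P. i l = m l} = (\<Prod>l\<in>{1..d}. m l)"
    if "l \<in> ?L" for l
  proof -
    have "card {i \<in> ?P. i l < m l} + card {i \<in> ?P. i l = m l} =
          card ({i \<in> ?P. i l < m l} \<union> {i \<in> ?P. i l = m l})"
      using finite_positions by (intro card_Un_disjoint[symmetric]) auto
    also have "{i \<in> ?P. i l < m l} \<union> {i \<in> ?P. i l = m l} = ?P"
      using range that by (auto simp: le_less)
    finally show ?thesis
      by (simp add: card_positions)
  qed
  thus ?thesis
    by (simp add: step wrap flip: sum.distrib)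
qed

section \<open>The total number of descents and cyclic descents\<close>

lemma sum_card_descending_pairs:
  assumes E: "E \<subseteq> positions d m \<times> positions d m" and ne: "\<And>i j. (i, j) \<in> E \<Longrightarrow> i \<noteq> j"
  shows "2 * (\<Sum>w\<in>tensor_words d m k. card {p \<in> E. w (fst p) > w (snd p)}) =
         card E * ((k - 1) * k ^ ((\<Prod>l\<in>{1..d}. m l) - 1))"
proof -
  have finE: "finite E"
    using E finite_positions by (meson finite_SigmaI finite_subset)
  have finW: "finite (tensor_words d m k)"
    by (auto simp: tensor_words_def intro!: finite_PiE finite_positions)
  have "(\<Sum>w\<in>tensor_words d m k. card {p \<in> E. w (fst p) > w (snd p)}) =
        (\<Sum>w\<in>tensor_words d m k. \<Sum>p | p \<in> E \<and> w (fst p) > w (snd p). 1)"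
    by simp
  also have "\<dots> = (\<Sum>p\<in>E. \<Sum>w | w \<in> tensor_words d m k \<and> w (fst p) > w (snd p). 1)"
    by (rule sum.swap_restrict[OF finW finE])
  finally have "2 * (\<Sum>w\<in>tensor_words d m k. card {p \<in> E. w (fst p) > w (snd p)}) =
      (\<Sum>p\<in>E. 2 * card {w \<in> tensor_words d m k. w (fst p) > w (snd p)})"
    by (simp add: sum_distrib_left)
  also have "\<dots> = (\<Sum>p\<in>E. (k - 1) * k ^ ((\<Prod>l\<in>{1..d}. m l) - 1))"
  proof (rule sum.cong)
    fix p assume "p \<in> E"
    hence "fst p \<in> positions d m" "snd p \<in> positions d m" "fst p \<noteq> snd p"
      using E ne[of "fst p" "snd p"] by auto
    from card_functions_descending[OF finite_positions this, of k]
    show "2 * card {w \<in> tensor_words d m k. w (fst p) > w (snd p)} =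
          (k - 1) * k ^ ((\<Prod>l\<in>{1..d}. m l) - 1)"
      by (simp add: tensor_words_def card_positions)
  qed simp
  finally show ?thesis by simp
qed

lemma total_cycdes_closed_form:
  "2 * total_cycdes d m k =
     card {l \<in> {1..d}. m l \<ge> 2} * (\<Prod>l\<in>{1..d}. m l) * ((k - 1) * k ^ ((\<Prod>l\<in>{1..d}. m l) - 1))"
proof -
  let ?c = "(k - 1) * k ^ ((\<Prod>l\<in>{1..d}. m l) - 1)"
  have step: "2 * (\<Sum>w\<in>tensor_words d m k. card (descents d m w)) = card (step_pairs d m) * ?c"
    unfolding descents_eq
  proof (rule sum_card_descending_pairs)
    show "i \<noteq> j" if ij: "(i, j) \<in> step_pairs d m" for i j
    proof -
      obtain l where "j = i(l := i l + 1)"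
        using ij by (auto simp: step_pairs_def)
      hence "j l = i l + 1" by simp
      thus ?thesis by auto
    qed
  qed (auto simp: step_pairs_def)
  have wrap: "2 * (\<Sum>w\<in>tensor_words d m k. card (cyclic_descents d m w)) =
              card (wrap_pairs d m) * ?c"
    unfolding cyclic_descents_eq by (rule sum_card_descending_pairs) (auto simp: wrap_pairs_def)
  have "2 * total_cycdes d m k = card (step_pairs d m) * ?c + card (wrap_pairs d m) * ?c"
    unfolding step[symmetric] wrap[symmetric]
    by (simp add: total_cycdes_def cycdes_def sum.distrib)
  also have "\<dots> = (card (step_pairs d m) + card (wrap_pairs d m)) * ?c"
    by (rule distrib_right[symmetric])
  finally show ?thesis
    unfolding card_step_wrap_pairs .
qed

corollary real_total_cycdes:
  assumes "k \<ge> 1" and "M = (\<Prod>l\<in>{1..d}. m l)"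
  shows "real (total_cycdes d m k) =
         1 / 2 * (real (card {l \<in> {1..d}. m l \<ge> 2}) * real M) * (real k - 1) * real k ^ (M - 1)"
proof -
  have "2 * real (total_cycdes d m k) = real (2 * total_cycdes d m k)"
    by simp
  also have "\<dots> = real (card {l \<in> {1..d}. m l \<ge> 2}) * real M * ((real k - 1) * real k ^ (M - 1))"
    unfolding total_cycdes_closed_form using assms by (simp add: of_nat_diff)
  finally show ?thesis by simp
qed

section \<open>The generating function\<close>

unbundle fps_syntax

text \<open>
  The series of \<open>n a\<^sup>n\<^sup>-\<^sup>1\<close> is the derivative of the geometric series with respect to \<open>a\<close>, so it is
  \<open>X / (1 - a X)\<^sup>2\<close>.  Concretely, one factor \<open>1 - a X\<close> reduces it to \<open>X\<close> times the geometric
  series, and the other one cancels that series.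
\<close>

lemma fps_linear_times_geometric:
  fixes a :: real
  shows "Abs_fps (\<lambda>n. real n * a ^ (n - 1)) * (1 - fps_const a * fps_X) ^ 2 = fps_X"
proof -
  let ?S = "Abs_fps (\<lambda>n. real n * a ^ (n - 1))"
  let ?Q = "Abs_fps (\<lambda>n. a ^ n) :: real fps"
  have S: "?S * (1 - fps_const a * fps_X) = fps_X * ?Q"
    (is "?lhs = _")
  proof (rule fps_ext)
    fix n
    have "?lhs = ?S - fps_const a * (?S * fps_X)"
      by (simp add: algebra_simps)
    thus "?lhs $ n = (fps_X * ?Q) $ n"
      by (cases n; cases "n - 1") (auto simp: algebra_simps)
  qed
  have Q: "?Q * (1 - fps_const a * fps_X) = 1"
    (is "?lhs = _")
  proof (rule fps_ext)
    fix n
    have "?lhs = ?Q - fps_const a * (?Q * fps_X)"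
      by (simp add: algebra_simps)
    thus "?lhs $ n = 1 $ n"
      by (cases n) auto
  qed
  have "?S * (1 - fps_const a * fps_X) ^ 2 =
        ?S * (1 - fps_const a * fps_X) * (1 - fps_const a * fps_X)"
    by (simp only: power2_eq_square mult.assoc)
  also have "\<dots> = fps_X * (?Q * (1 - fps_const a * fps_X))"
    by (simp only: S mult.assoc)
  finally show ?thesis
    by (simp only: Q mult_1_right)
qed

theorem theorem7:
  fixes d k M :: nat and m :: "nat \<Rightarrow> nat" and g :: real
  assumes "k \<ge> 1" and "d \<ge> 1" and "\<forall>l\<in>{1..d}. m l \<ge> 1"
    and M: "M = (\<Prod>l\<in>{1..d}. m l)"
    and g: "g = real (total_cycdes d m k)"
  shows "(k = 1 \<or> (\<forall>l\<in>{1..d}. m l \<ge> 2) \<longrightarrow>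
            g = 1 / 2 * (real d * real M) * (real k - 1) * real k ^ (M - 1)) \<and>
         cycdes_gf d m k = fps_const g * fps_X +
           (fps_const (2 * (1 / 2 * (real k - 1) * real k ^ (2 * M - 1) * real M + real k ^ M * g))
              / (1 - fps_const (real k ^ M) * fps_X) ^ 2 * fps_X ^ 2
            - fps_const (1 / 2 * (real k - 1) * real k ^ (3 * M - 1) * real M + real k ^ (2 * M) * g)
              / (1 - fps_const (real k ^ M) * fps_X) ^ 2 * fps_X ^ 3)"
proof
  let ?r = "card {l \<in> {1..d}. m l \<ge> 2}"
  have g_r: "g = 1 / 2 * (real ?r * real M) * (real k - 1) * real k ^ (M - 1)"
    unfolding g by (rule real_total_cycdes[OF assms(1) M])
  have "?r = d" if "\<forall>l\<in>{1..d}. m l \<ge> 2"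
  proof -
    have "{l \<in> {1..d}. m l \<ge> 2} = {1..d}"
      using that by auto
    thus ?thesis by simp
  qed
  thus "k = 1 \<or> (\<forall>l\<in>{1..d}. m l \<ge> 2) \<longrightarrow>
        g = 1 / 2 * (real d * real M) * (real k - 1) * real k ^ (M - 1)"
    using g_r by auto

  have M1: "M \<ge> 1"
    using assms(3) unfolding M by (intro prod_ge_1) auto
  \<comment> \<open>\<open>B\<close> is the value that the pattern of the coefficients at \<open>n \<ge> 2\<close> would give at \<open>n = 1\<close>, where
    the new direction in fact contributes nothing.\<close>
  define a where "a = real k ^ M"
  define B where "B = 1 / 2 * (real (?r + 1) * real M) * (real k - 1) * real k ^ (M - 1)"
  have coeff1: "total_cycdes (d + 1) (m(d + 1 := 1)) k = total_cycdes d m k"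
  proof -
    have "{l \<in> {1..d + 1}. (m(d + 1 := 1)) l \<ge> 2} = {l \<in> {1..d}. m l \<ge> 2}"
      by auto
    moreover have "(\<Prod>l\<in>{1..d + 1}. (m(d + 1 := 1)) l) = M"
      unfolding M by (simp add: prod.nat_ivl_Suc')
    ultimately have "2 * total_cycdes (d + 1) (m(d + 1 := 1)) k = 2 * total_cycdes d m k"
      unfolding total_cycdes_closed_form by (simp only: M)
    thus ?thesis by simp
  qed
  have coeff2: "real (total_cycdes (d + 1) (m(d + 1 := n)) k) = B * (real n * a ^ (n - 1))"
    if "n \<ge> 2" for n
  proof -
    have "{l \<in> {1..d + 1}. (m(d + 1 := n)) l \<ge> 2} = insert (d + 1) {l \<in> {1..d}. m l \<ge> 2}"
      using that by auto
    hence r: "card {l \<in> {1..d + 1}. (m(d + 1 := n)) l \<ge> 2} = ?r + 1"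
      by simp
    have "M * n = (\<Prod>l\<in>{1..d + 1}. (m(d + 1 := n)) l)"
      unfolding M by (simp add: prod.nat_ivl_Suc')
    from real_total_cycdes[OF assms(1) this]
    have "real (total_cycdes (d + 1) (m(d + 1 := n)) k) =
          1 / 2 * (real (?r + 1) * real (M * n)) * (real k - 1) * real k ^ (M * n - 1)"
      unfolding r .
    moreover have "M * n - 1 = (M - 1) + M * (n - 1)"
      using M1 that by (cases n) auto
    ultimately show ?thesis
      by (simp add: B_def a_def power_add power_mult)
  qed
  let ?S = "Abs_fps (\<lambda>n. real n * a ^ (n - 1))"
  let ?D = "(1 - fps_const a * fps_X) ^ 2 :: real fps"
  have "cycdes_gf d m k = fps_const g * fps_X + fps_const B * (?S - fps_X)"
  proof (rule fps_ext)
    fix n :: nat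
    consider "n = 0" | "n = 1" | "n \<ge> 2" by linarith
    thus "cycdes_gf d m k $ n = (fps_const g * fps_X + fps_const B * (?S - fps_X)) $ n"
    proof cases
      case 2
      thus ?thesis using coeff1 by (simp add: cycdes_gf_def g)
    next
      case 3
      thus ?thesis using coeff2[OF 3] by (simp add: cycdes_gf_def)
    qed (simp add: cycdes_gf_def)
  qed
  \<comment> \<open>Over the common denominator, \<open>X / (1 - a X)\<^sup>2 - X\<close> has the numerator
    \<open>X - X (1 - a X)\<^sup>2 = 2 a X\<^sup>2 - a\<^sup>2 X\<^sup>3\<close>.\<close>
  also have "fps_const B * (?S - fps_X) =
      fps_const (2 * (a * B)) / ?D * fps_X ^ 2 - fps_const (a ^ 2 * B) / ?D * fps_X ^ 3"
  proof -
    have D0: "?D $ 0 \<noteq> 0"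
      by (simp add: power2_eq_square)
    hence inv: "?D * inverse ?D = 1"
      by (metis inverse_mult_eq_1 mult.commute)
    have "fps_const B * (?S - fps_X) = fps_const B * (?S * ?D - fps_X * ?D) * inverse ?D"
      using inv by (simp add: left_diff_distrib mult.assoc)
    also have "\<dots> = fps_const B * (fps_X - fps_X * ?D) * inverse ?D"
      by (simp only: fps_linear_times_geometric)
    also have "fps_const B * (fps_X - fps_X * ?D) =
        fps_const (2 * (a * B)) * fps_X ^ 2 - fps_const (a ^ 2 * B) * fps_X ^ 3"
    proof -
      have "fps_const (2 * (a * B)) = 2 * (fps_const a * fps_const B)"
        by (simp add: numeral_fps_const)
      moreover have "fps_const (a ^ 2 * B) = fps_const a ^ 2 * fps_const B"
        by (simp add: power2_eq_square)
      ultimately show ?thesis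
        by (simp only:) (simp add: algebra_simps power2_eq_square power3_eq_cube)
    qed
    finally show ?thesis
      using D0 by (simp add: fps_divide_unit algebra_simps)
  qed
  also have "a * B = 1 / 2 * (real k - 1) * real k ^ (2 * M - 1) * real M + real k ^ M * g"
  proof -
    have "2 * M - 1 = M + (M - 1)" using M1 by simp
    thus ?thesis
      unfolding a_def B_def g_r by (simp add: power_add algebra_simps)
  qed
  also have "a ^ 2 * B = 1 / 2 * (real k - 1) * real k ^ (3 * M - 1) * real M + real k ^ (2 * M) * g"
  proof -
    have "3 * M - 1 = 2 * M + (M - 1)" using M1 by simp
    moreover have "a ^ 2 = real k ^ (2 * M)"
      by (simp add: a_def power_mult[symmetric] mult.commute)
    ultimately show ?thesis
      unfolding B_def g_r by (simp add: power_add algebra_simps)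
  qed
  finally show "cycdes_gf d m k = fps_const g * fps_X +
           (fps_const (2 * (1 / 2 * (real k - 1) * real k ^ (2 * M - 1) * real M + real k ^ M * g))
              / (1 - fps_const (real k ^ M) * fps_X) ^ 2 * fps_X ^ 2
            - fps_const (1 / 2 * (real k - 1) * real k ^ (3 * M - 1) * real M + real k ^ (2 * M) * g)
              / (1 - fps_const (real k ^ M) * fps_X) ^ 2 * fps_X ^ 3)"
    unfolding a_def .
qed

end
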